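(* Let $p\in\mathbb{R}\setminus\{0\}$, let $0<a<b$, and let $f:[a,b]\to\mathbb{R}$ be integrable on $[a,b]$ and symmetrized $p$-convex on $[a,b]$. Then for all $x,y\in[a,b]$ with $x\neq y$, $$\frac12\left[f\left(\left[\frac{x^{p}+y^{p}}{2}\right]^{1/p}\right)+f\left(\left[a^{p}+b^{p}-\frac{x^{p}+y^{p}}{2}\right]^{1/p}\right)\right]$$ $$\le \frac{p}{2(y^{p}-x^{p})}\left[\int_{x}^{y}\frac{f(t)}{t^{1-p}}\,dt+\int_{[a^{p}+b^{p}-y^{p}]^{1/p}}^{[a^{p}+b^{p}-x^{p}]^{1/p}}\frac{f(t)}{t^{1-p}}\,dt\right]$$ $$\le \frac14\left[f(x)+f(y)+f\left([a^{p}+b^{p}-x^{p}]^{1/p}\right)+f\left([a^{p}+b^{p}-y^{p}]^{1/p}\right)\right].$$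
   Context: Let $p\in\mathbb{R}\setminus\{0\}$. A function $h:I\to\mathbb{R}$ on a real interval $I\subseteq(0,\infty)$ is called $p$-convex if $h\left([tx^{p}+(1-t)y^{p}]^{1/p}\right)\le t\,h(x)+(1-t)\,h(y)$ for all $x,y\in I$ and $t\in[0,1]$. For $f:[a,b]\to\mathbb{R}$ with $[a,b]\subseteq(0,\infty)$, the $p$-symmetrical transform of $f$ on $[a,b]$ is the function $P_{(f;p)}(x)=\frac12\left[f(x)+f\left([a^{p}+b^{p}-x^{p}]^{1/p}\right)\right]$, $x\in[a,b]$. The function $f$ is called symmetrized $p$-convex on $[a,b]$ if $P_{(f;p)}$ is $p$-convex on $[a,b]$. Integrals are oriented: $\int_{u}^{v}=-\int_{v}^{u}$. *)

theory Defs
  imports "HOL-Analysis.Analysis"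
begin

definition p_convex_on :: "real \<Rightarrow> real set \<Rightarrow> (real \<Rightarrow> real) \<Rightarrow> bool" where
  "p_convex_on p I h \<longleftrightarrow>
     p \<noteq> 0 \<and> is_interval I \<and> I \<subseteq> {0<..} \<and>
     (\<forall>x\<in>I. \<forall>y\<in>I. \<forall>t\<in>{0..1}.
        h ((t * x powr p + (1 - t) * y powr p) powr (1 / p)) \<le> t * h x + (1 - t) * h y)"

definition p_symmetrical_transform ::
    "real \<Rightarrow> real \<Rightarrow> real \<Rightarrow> (real \<Rightarrow> real) \<Rightarrow> real \<Rightarrow> real" where
  "p_symmetrical_transform p a b f x =
     1 / 2 * (f x + f ((a powr p + b powr p - x powr p) powr (1 / p)))"

definition symmetrized_p_convex_on ::
    "real \<Rightarrow> real \<Rightarrow> real \<Rightarrow> (real \<Rightarrow> real) \<Rightarrow> bool" where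
  "symmetrized_p_convex_on p a b f \<longleftrightarrow>
     p_convex_on p {a..b} (p_symmetrical_transform p a b f)"

end

theory Submission
  imports Defs
begin

text \<open>
  The substitution \<open>s = t\<^sup>p\<close> turns the weighted integrals into plain integrals of
  \<open>g(s) = f(s\<^bsup>1/p\<^esup>)\<close>, and \<open>p\<close>-convexity into ordinary convexity. With \<open>c = a\<^sup>p + b\<^sup>p\<close>,
  the reflection \<open>s \<mapsto> c - s\<close> merges the two integrals into one integral of
  \<open>G(s) = (g(s) + g(c - s)) / 2\<close> between \<open>x\<^sup>p\<close> and \<open>y\<^sup>p\<close>, and the claim is the
  Hermite--Hadamard inequality for the convex function \<open>G\<close>.
\<close>

section \<open>Reflection and the Hermite-Hadamard inequality\<close>

lemma has_integral_reflect_Icc: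
  fixes h :: "real \<Rightarrow> real"
  assumes "(h has_integral i) {c - v..c - u}"
  shows "((\<lambda>s. h (c - s)) has_integral i) {u..v}"
proof -
  have "(\<lambda>s. c - s) ` {c - v..c - u} = {u..v}"
    using image_diff_atLeastAtMost[of c "c - v" "c - u"] by simp
  with has_integral_affinity[of h i "c - v" "c - u" "-1" c] assms show ?thesis
    by (simp add: add.commute)
qed

text \<open>Both bounds come from averaging \<open>G\<close> with its reflection about the midpoint: convexity
  squeezes \<open>G s + G (u + v - s)\<close> between the constants \<open>2 G ((u + v) / 2)\<close> and \<open>G u + G v\<close>.\<close>

lemma hermite_hadamard:
  fixes G :: "real \<Rightarrow> real"
  assumes "convex_on {u..v} G" and "u < v" and "(G has_integral i) {u..v}"
  shows "G ((u + v) / 2) * (v - u) \<le> i" and "i \<le> (G u + G v) / 2 * (v - u)"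
proof -
  have sum: "((\<lambda>s. G s + G (u + v - s)) has_integral i + i) {u..v}"
    using assms(3) by (intro has_integral_add has_integral_reflect_Icc) auto
  have const: "((\<lambda>_. k) has_integral k * (v - u)) {u..v}" for k :: real
    using has_integral_const_real[of k u v] assms(2) by (simp add: mult.commute)
  have "2 * G ((u + v) / 2) \<le> G s + G (u + v - s)" if "s \<in> {u..v}" for s
  proof -
    have "G ((1 - 1/2) *\<^sub>R s + (1/2) *\<^sub>R (u + v - s)) \<le> (1 - 1/2) * G s + 1/2 * G (u + v - s)"
      using that by (intro convex_onD[OF assms(1)]) auto
    then show ?thesis
      by (simp add: field_simps)
  qed
  from has_integral_le[OF const sum this] show "G ((u + v) / 2) * (v - u) \<le> i"
    by simp
  have "G s + G (u + v - s) \<le> G u + G v" if "s \<in> {u..v}" for s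
  proof -
    \<comment> \<open>The chord over \<open>{u..v}\<close> bounds \<open>G\<close> at
      \<open>s\<close>, written from the left end, and at \<open>u + v - s\<close>, written from the
      right end. In this form the two slope terms are opposite and cancel in the sum.\<close>
    have "G s \<le> (G v - G u) / (v - u) * (s - u) + G u"
      using convex_onD_Icc'[OF assms(1)] that by simp
    moreover have "G (u + v - s) \<le> (G u - G v) / (v - u) * (s - u) + G v"
      using convex_onD_Icc''[OF assms(1), of "u + v - s"] that by simp
    moreover have "(G v - G u) / (v - u) * (s - u) = - ((G u - G v) / (v - u) * (s - u))"
      by (metis minus_diff_eq minus_divide_left mult_minus_left)
    ultimately show ?thesis
      by linarith
  qed
  from has_integral_le[OF sum const this] show "i \<le> (G u + G v) / 2 * (v - u)"
    by simp
qed

section \<open>Power maps on positive intervals\<close>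

lemma powr_powr_inverse [simp]:
  fixes p s :: real
  assumes "p \<noteq> 0" and "0 < s"
  shows "(s powr (1 / p)) powr p = s" and "(s powr p) powr (1 / p) = s"
  using assms by (simp_all add: powr_powr)

lemma powr_le_cancel_neg:
  fixes q s t :: real
  assumes "q < 0" and "0 < s" and "0 < t"
  shows "s powr q \<le> t powr q \<longleftrightarrow> t \<le> s"
  using assms powr_mono2'[of q t s] powr_less_mono2_neg[of q s t] by (meson le_less not_le)

lemma powr_le_cancel_pos:
  fixes q s t :: real
  assumes "0 < q" and "0 < s" and "0 < t"
  shows "s powr q \<le> t powr q \<longleftrightarrow> s \<le> t"
  using assms powr_mono2[of q s t] powr_less_mono2[of q t s] by (meson le_less not_le)

text \<open>The power map increases for \<open>p > 0\<close> and decreases for \<open>p < 0\<close>;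
  \<open>min\<close> and \<open>max\<close> cover both cases. Surjectivity comes from the inverse
  map with exponent \<open>1 / p\<close>.\<close>

lemma powr_image_Icc:
  fixes p u v :: real
  assumes "p \<noteq> 0" and "0 < u" and "u \<le> v"
  shows "(\<lambda>s. s powr p) ` {u..v} = {min (u powr p) (v powr p)..max (u powr p) (v powr p)}"
    (is "?h ` _ = ?S")
proof
  have le: "s powr p \<le> t powr p \<longleftrightarrow> (if 0 < p then s \<le> t else t \<le> s)" if "0 < s" "0 < t" for s t
    using powr_le_cancel_pos powr_le_cancel_neg that assms(1) by (cases "0 < p") auto
  show "?h ` {u..v} \<subseteq> ?S"
    using assms le by (auto simp: min_le_iff_disj le_max_iff_disj)
  show "?S \<subseteq> ?h ` {u..v}"
  proof
    fix t assume t: "t \<in> ?S"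
    define s where "s = t powr (1 / p)"
    have "0 < min (u powr p) (v powr p)"
      using assms by simp
    also have "\<dots> \<le> t"
      using t by simp
    finally have "0 < t" .
    then have "0 < s" and [simp]: "s powr p = t"
      using assms(1) by (simp_all add: s_def)
    have "u \<le> s \<and> s \<le> v"
    proof (cases "0 < p")
      case True
      then have "min (u powr p) (v powr p) = u powr p" "max (u powr p) (v powr p) = v powr p"
        using le[of u v] assms by auto
      then have "u powr p \<le> s powr p" "s powr p \<le> v powr p"
        using t by auto
      then show ?thesis
        using le[of u s] le[of s v] True \<open>0 < s\<close> assms by simp
    next
      case False
      then have "min (u powr p) (v powr p) = v powr p" "max (u powr p) (v powr p) = u powr p"
        using le[of v u] assms by auto
      then have "v powr p \<le> s powr p" "s powr p \<le> u powr p"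
        using t by auto
      then show ?thesis
        using le[of v s] le[of s u] False \<open>0 < s\<close> assms by simp
    qed
    then show "t \<in> ?h ` {u..v}"
      by (intro image_eqI[of _ _ s]) auto
  qed
qed

section \<open>Weighted and oriented integrals\<close>

text \<open>Since \<open>0 < l\<close>, the weight is continuous on a compact interval, hence
  bounded and measurable, and multiplying by it preserves absolute integrability.\<close>

lemma absolutely_integrable_divide_powr:
  fixes f :: "real \<Rightarrow> real"
  assumes "f absolutely_integrable_on {l..r}" and "0 < l"
  shows "(\<lambda>t. f t / t powr q) absolutely_integrable_on {l..r}"
proof -
  have cont: "continuous_on {l..r} (\<lambda>t. 1 / t powr q)"
    using assms(2) by (intro continuous_intros) auto
  have "(\<lambda>t. 1 / t powr q * f t) absolutely_integrable_on {l..r}"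
  proof (rule absolutely_integrable_bounded_measurable_product_real)
    show "(\<lambda>t. 1 / t powr q) \<in> borel_measurable (lebesgue_on {l..r})"
      using cont by (intro continuous_imp_measurable_on_sets_lebesgue) auto
    show "bounded ((\<lambda>t. 1 / t powr q) ` {l..r})"
      using cont by (intro compact_imp_bounded compact_continuous_image) auto
  qed (use assms in auto)
  then show ?thesis
    by simp
qed

lemma interval_lebesgue_integral_reverse:
  fixes l r :: real and f :: "real \<Rightarrow> real"
  shows "(LINT t=l..r|M. f t) = - (LINT t=r..l|M. f t)"
  by (cases l r rule: linorder_cases)
    (simp_all add: interval_lebesgue_integral_def einterval_same set_lebesgue_integral_def)

text \<open>The oriented integral is taken over the open interval; adding the two endpoints does not
  change its value.\<close>

lemma interval_integral_eq_integral_Icc: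
  fixes F :: "real \<Rightarrow> real"
  assumes "F absolutely_integrable_on {l..r}" and "l \<le> r"
  shows "(LINT t=l..r|lebesgue. F t) = integral {l..r} F"
proof -
  have "F absolutely_integrable_on {l<..<r}"
    using assms(1) by (rule set_integrable_subset) auto
  then have "(LINT t:{l<..<r}|lebesgue. F t) = integral {l<..<r} F"
    by (rule set_lebesgue_integral_eq_integral)
  then show ?thesis
    using assms(2) by (simp add: interval_lebesgue_integral_def integral_open_interval_real)
qed

text \<open>Orientation makes the formula uniform in the sign of \<open>p\<close>: for \<open>p < 0\<close> the endpoints
  \<open>u\<^bsup>1/p\<^esup>\<close> and \<open>v\<^bsup>1/p\<^esup>\<close> are in reverse order.\<close>

lemma powr_substitution:
  fixes f :: "real \<Rightarrow> real"
  assumes p: "p \<noteq> 0" and u: "0 < u" and uv: "u \<le> v"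
    and f: "f absolutely_integrable_on (\<lambda>s. s powr (1 / p)) ` {u..v}"
  shows "(\<lambda>s. f (s powr (1 / p))) absolutely_integrable_on {u..v}"
    and "(LINT t=u powr (1 / p)..v powr (1 / p)|lebesgue. (f t / t powr (1 - p)))
          = 1 / p * integral {u..v} (\<lambda>s. f (s powr (1 / p)))"
proof -
  let ?h = "\<lambda>s. s powr (1 / p)"
  let ?l = "min (?h u) (?h v)" and ?r = "max (?h u) (?h v)"
  let ?F = "\<lambda>t. f t / t powr (1 - p)"
  have img: "?h ` {u..v} = {?l..?r}"
    using powr_image_Icc[of "1 / p" u v] p u uv by simp
  have F: "?F absolutely_integrable_on {?l..?r}"
    using f u uv unfolding img by (intro absolutely_integrable_divide_powr) auto
  have inj: "inj_on ?h {u..v}"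
    by (rule inj_on_inverseI[of _ "\<lambda>t. t powr p"]) (use p u in auto)
  have der: "(?h has_field_derivative 1 / p * s powr (1 / p - 1)) (at s within {u..v})"
    if "s \<in> {u..v}" for s
    using that u by (auto intro!: derivative_eq_intros)
  \<comment> \<open>At \<open>t = s powr (1 / p)\<close> the weight \<open>t powr (1 - p)\<close>
    equals \<open>s powr (1 / p - 1)\<close>, so it cancels the Jacobian up to a constant.\<close>
  have eq: "\<bar>1 / p * s powr (1 / p - 1)\<bar> * ?F (?h s) = \<bar>1 / p\<bar> * f (?h s)" if "s \<in> {u..v}" for s
  proof -
    have "1 / p * (1 - p) = 1 / p - 1"
      using p by (simp add: field_simps)
    then have "?h s powr (1 - p) = s powr (1 / p - 1)"
      by (simp only: powr_powr)
    then show ?thesis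
      using that u by (simp add: abs_mult)
  qed
  have "(\<lambda>s. \<bar>1 / p * s powr (1 / p - 1)\<bar> * ?F (?h s)) absolutely_integrable_on {u..v} \<and>
        integral {u..v} (\<lambda>s. \<bar>1 / p * s powr (1 / p - 1)\<bar> * ?F (?h s)) = integral {?l..?r} ?F"
    using has_absolute_integral_change_of_variables_1'[OF _ der inj, of ?F "integral {?l..?r} ?F"]
      F unfolding img by simp
  then have int: "(\<lambda>s. \<bar>1 / p\<bar> * f (?h s)) absolutely_integrable_on {u..v}"
    and val: "integral {u..v} (\<lambda>s. \<bar>1 / p\<bar> * f (?h s)) = integral {?l..?r} ?F"
    by (simp_all only: eq cong: set_integrable_cong integral_cong)
  show "(\<lambda>s. f (?h s)) absolutely_integrable_on {u..v}"
    using set_integrable_mult_right[OF int, of "\<bar>p\<bar>"] p by (simp add: abs_divide)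
  show "(LINT t=?h u..?h v|lebesgue. ?F t) = 1 / p * integral {u..v} (\<lambda>s. f (?h s))"
  \<comment> \<open>The change of variables is unsigned and yields the factor
    \<open>\<bar>1 / p\<bar>\<close>. For \<open>p < 0\<close> the reversed endpoints supply the
    missing sign.\<close>
  proof (cases "0 < p")
    case True
    then have "?h u \<le> ?h v"
      using u uv by (intro powr_mono2) auto
    then show ?thesis
      using True F val interval_integral_eq_integral_Icc[of "?h u" "?h v" ?F]
      by (simp add: min_def max_def)
  next
    case False
    then have "?h v \<le> ?h u"
      using u uv p by (intro powr_mono2') auto
    then have "?l = ?h v" "?r = ?h u"
      by auto
    then have "(LINT t=?h v..?h u|lebesgue. ?F t) = \<bar>1 / p\<bar> * integral {u..v} (\<lambda>s. f (?h s))"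
      using F val \<open>?h v \<le> ?h u\<close> by (simp add: interval_integral_eq_integral_Icc)
    then show ?thesis
      using False p
        interval_lebesgue_integral_reverse[of lebesgue "?h u" "?h v" ?F]
      by (simp add: abs_if)
  qed
qed

section \<open>From \<open>p\<close>-convexity to the two bounds\<close>

text \<open>In the coordinate \<open>s = x powr p\<close>, the weighted power mean of exponent
  \<open>p\<close> becomes the weighted arithmetic mean.\<close>

lemma p_convex_on_imp_convex_on:
  assumes "p_convex_on p {a..b} h" and "0 < a" and "a \<le> b"
  shows "convex_on ((\<lambda>x. x powr p) ` {a..b}) (\<lambda>s. h (s powr (1 / p)))"
proof
  have p: "p \<noteq> 0"
    using assms(1) by (simp add: p_convex_on_def)
  show "convex ((\<lambda>x. x powr p) ` {a..b})"
    using p assms by (simp add: powr_image_Icc)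
  fix t s s' :: real
  assume t: "0 < t" "t < 1" and "s \<in> (\<lambda>x. x powr p) ` {a..b}" "s' \<in> (\<lambda>x. x powr p) ` {a..b}"
  then obtain x y where xy: "x \<in> {a..b}" "y \<in> {a..b}" "s = x powr p" "s' = y powr p"
    by blast
  have "\<forall>x\<in>{a..b}. \<forall>y\<in>{a..b}. \<forall>t\<in>{0..1}.
      h ((t * x powr p + (1 - t) * y powr p) powr (1 / p)) \<le> t * h x + (1 - t) * h y"
    using assms(1) by (simp add: p_convex_on_def)
  \<comment> \<open>Convexity puts the weight \<open>t\<close> on the second point,
    \<open>p\<close>-convexity on the first; hence \<open>1 - t\<close>.\<close>
  from this[rule_format, OF xy(1,2), of "1 - t"] t
  have "h (((1 - t) * x powr p + (1 - (1 - t)) * y powr p) powr (1 / p))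
      \<le> (1 - t) * h x + (1 - (1 - t)) * h y"
    by simp
  then show "h (((1 - t) *\<^sub>R s + t *\<^sub>R s') powr (1 / p))
      \<le> (1 - t) * h (s powr (1 / p)) + t * h (s' powr (1 / p))"
    using xy p assms(2) by simp
qed

text \<open>The order is imposed on the powers rather than on \<open>x\<close> and \<open>y\<close>,
  so that \<open>{u..v}\<close> is a proper interval for either sign of \<open>p\<close>.\<close>

lemma symmetrized_p_convex_hermite_hadamard:
  fixes p a b c x y I :: real and f :: "real \<Rightarrow> real"
  assumes p: "p \<noteq> 0" and a: "0 < a" and ab: "a < b"
    and f: "f absolutely_integrable_on {a..b}"
    and conv: "symmetrized_p_convex_on p a b f"
    and x: "x \<in> {a..b}" and y: "y \<in> {a..b}" and less: "x powr p < y powr p"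
    and c_def: "c = a powr p + b powr p"
    and I_def: "I = (LINT t=x..y|lebesgue. (f t / t powr (1 - p)))
       + (LINT t=(c - y powr p) powr (1 / p)..(c - x powr p) powr (1 / p)|lebesgue.
            (f t / t powr (1 - p)))"
  shows "1 / 2 * (f (((x powr p + y powr p) / 2) powr (1 / p))
              + f ((c - (x powr p + y powr p) / 2) powr (1 / p)))
         \<le> p / (2 * (y powr p - x powr p)) * I"
    and "p / (2 * (y powr p - x powr p)) * I
         \<le> 1 / 4 * (f x + f y + f ((c - x powr p) powr (1 / p)) + f ((c - y powr p) powr (1 / p)))"
proof -
  define u v where "u = x powr p" and "v = y powr p"
  define D where "D = (\<lambda>t. t powr p) ` {a..b}"
  define g where "g = (\<lambda>s. f (s powr (1 / p)))"
  define G where "G = (\<lambda>s. 1 / 2 * (g s + g (c - s)))"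
  have D: "D = {min (a powr p) (b powr p)..max (a powr p) (b powr p)}"
    using powr_image_Icc[of p a b] p a ab by (simp add: D_def)
  have "u \<in> D" "v \<in> D" "u < v"
    using x y less by (auto simp: D_def u_def v_def)
  \<comment> \<open>\<open>c\<close> is the sum of the endpoints of \<open>D\<close>, so reflection
    maps \<open>D\<close> onto itself.\<close>
  then have sub: "{u..v} \<subseteq> D" "{c - v..c - u} \<subseteq> D"
    unfolding D c_def by (auto simp: min_def max_def)
  have pos: "0 < s" if "s \<in> D" for s
    using that a by (auto simp: D_def)
  have [simp]: "u powr (1 / p) = x" "v powr (1 / p) = y"
    using x y a p by (auto simp: u_def v_def)
  have subst: "(g has_integral p * (LINT t=s powr (1 / p)..s' powr (1 / p)|lebesgue. (f t / t powr (1 - p)))) {s..s'}"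
    if "{s..s'} \<subseteq> D" "s < s'" for s s'
  proof -
    have "0 < s"
      using that by (intro pos) auto
    \<comment> \<open>\<open>D\<close> is the image of \<open>{a..b}\<close>, so the inverse power
      map sends \<open>{s..s'}\<close> back into \<open>{a..b}\<close>, where \<open>f\<close> is
      integrable.\<close>
    have "(\<lambda>s. s powr (1 / p)) ` {s..s'} \<subseteq> {a..b}"
      using that(1) a p by (auto simp: D_def subset_iff image_iff Ball_def)
    moreover have "(\<lambda>s. s powr (1 / p)) ` {s..s'} \<in> sets lebesgue"
      using powr_image_Icc[of "1 / p" s s'] p \<open>0 < s\<close> that(2) by simp
    ultimately have "f absolutely_integrable_on (\<lambda>s. s powr (1 / p)) ` {s..s'}"
      using f set_integrable_subset by blast
    note * = powr_substitution[OF p \<open>0 < s\<close> less_imp_le[OF that(2)] this]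
    show ?thesis
      using set_lebesgue_integral_eq_integral(1)[OF *(1)] *(2) p
      by (simp add: g_def has_integral_iff)
  qed
  have G_int: "(G has_integral 1 / 2 * (p * I)) {u..v}"
  proof -
    have "((\<lambda>s. g (c - s)) has_integral p *
        (LINT t=(c - v) powr (1 / p)..(c - u) powr (1 / p)|lebesgue. (f t / t powr (1 - p)))) {u..v}"
      using subst[of "c - v" "c - u"] sub \<open>u < v\<close> by (intro has_integral_reflect_Icc) auto
    from has_integral_mult_right[OF has_integral_add[OF subst[OF sub(1) \<open>u < v\<close>] this], of "1 / 2"]
    show ?thesis
      by (simp add: G_def I_def u_def[symmetric] v_def[symmetric] ring_distribs)
  qed
  have "convex_on D (\<lambda>s. p_symmetrical_transform p a b f (s powr (1 / p)))"
    using p_convex_on_imp_convex_on conv a ab unfolding D_def symmetrized_p_convex_on_def by simp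
  \<comment> \<open>Positivity on \<open>D\<close> is what makes the two powers inverse to each
    other.\<close>
  moreover have "p_symmetrical_transform p a b f (s powr (1 / p)) = G s" if "s \<in> D" for s
    using pos[OF that] p by (simp add: p_symmetrical_transform_def G_def g_def c_def)
  ultimately have "convex_on D G"
    unfolding convex_on_def convex_def by (metis (no_types, lifting))
  then have conv: "convex_on {u..v} G"
    using sub convex_on_subset by blast
  have I: "p / (2 * (v - u)) * I = (1 / 2 * (p * I)) / (v - u)"
    by simp
  have gx: "g u = f x" "g v = f y"
    by (simp_all add: g_def)
  show "1 / 2 * (f (((x powr p + y powr p) / 2) powr (1 / p))
              + f ((c - (x powr p + y powr p) / 2) powr (1 / p)))
         \<le> p / (2 * (y powr p - x powr p)) * I"
    using hermite_hadamard(1)[OF conv \<open>u < v\<close> G_int] \<open>u < v\<close>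
    unfolding u_def[symmetric] v_def[symmetric] I
    by (subst pos_le_divide_eq) (auto simp: G_def g_def)
  have "p / (2 * (v - u)) * I \<le> (G u + G v) / 2"
    using hermite_hadamard(2)[OF conv \<open>u < v\<close> G_int] \<open>u < v\<close>
    unfolding I by (subst pos_divide_le_eq) auto
  also have "\<dots> = 1 / 4 * (f x + f y + f ((c - u) powr (1 / p)) + f ((c - v) powr (1 / p)))"
    unfolding G_def gx by (simp add: g_def field_simps)
  finally show "p / (2 * (y powr p - x powr p)) * I
         \<le> 1 / 4 * (f x + f y + f ((c - x powr p) powr (1 / p)) + f ((c - y powr p) powr (1 / p)))"
    unfolding u_def v_def .
qed

theorem theorem13:
  fixes p a b x y :: real and f :: "real \<Rightarrow> real"
  assumes "p \<noteq> 0"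
    and "0 < a" and "a < b"
    and "set_integrable lebesgue {a..b} f"
    and "symmetrized_p_convex_on p a b f"
    and "x \<in> {a..b}" and "y \<in> {a..b}" and "x \<noteq> y"
  shows "1 / 2 * (f (((x powr p + y powr p) / 2) powr (1 / p))
              + f ((a powr p + b powr p - (x powr p + y powr p) / 2) powr (1 / p)))
         \<le> p / (2 * (y powr p - x powr p)) *
             ((LINT t=x..y|lebesgue. (f t / t powr (1 - p)))
              + (LINT t=((a powr p + b powr p - y powr p) powr (1 / p))
                  ..((a powr p + b powr p - x powr p) powr (1 / p))|lebesgue. (f t / t powr (1 - p))))
       \<and> p / (2 * (y powr p - x powr p)) *
             ((LINT t=x..y|lebesgue. (f t / t powr (1 - p)))
              + (LINT t=((a powr p + b powr p - y powr p) powr (1 / p))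
                  ..((a powr p + b powr p - x powr p) powr (1 / p))|lebesgue. (f t / t powr (1 - p))))
         \<le> 1 / 4 * (f x + f y + f ((a powr p + b powr p - x powr p) powr (1 / p))
                     + f ((a powr p + b powr p - y powr p) powr (1 / p)))"
proof (cases "x powr p < y powr p")
  case True
  then show ?thesis
    using symmetrized_p_convex_hermite_hadamard[OF assms(1-7) True refl refl] by blast
next
  case False
  have "x powr p \<noteq> y powr p"
    using assms powr_powr_inverse(2)[of p x] powr_powr_inverse(2)[of p y]
    by (metis atLeastAtMost_iff less_le_trans)
  with False have less: "y powr p < x powr p"
    by simp
  \<comment> \<open>Exchanging \<open>x\<close> and \<open>y\<close> reverses both oriented
    integrals and the sign of the denominator, so the middle term is symmetric in \<open>x\<close>
    and \<open>y\<close>, as are the outer ones.\<close>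
  have swap: "p / (2 * (x powr p - y powr p)) * (i + j)
      = p / (2 * (y powr p - x powr p)) * (- i + - j)" for i j :: real
    using less by (simp add: divide_simps) (simp add: algebra_simps)
  note * = symmetrized_p_convex_hermite_hadamard[OF assms(1-5,7,6) less refl refl]
  show ?thesis
    using * unfolding swap interval_lebesgue_integral_reverse[symmetric]
    by (simp add: add_ac)
qed

end
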